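(* Let $1\le n\le 3$ and let $d_1\le\cdots\le d_n$ be positive integers. Let $I=(f_1,\dots,f_n)$ be a generic homogeneous ideal of type $(n;d_1,\dots,d_n)$ in $K[x_1,\dots,x_n]$. Then Pardue's conjecture holds for $I$: whenever $x^\mu$ is a minimal generator of $\operatorname{in}(I)$ with $\max(x^\mu)=m$ and $\deg(x^\mu)=d$, every monomial of degree $d$ in the variables $x_1,\dots,x_{m-1}$ belongs to $\operatorname{in}(I)$.
   Context: $K$ is an infinite field that is an extension of a base field $F$. A form of degree $d$ in $K[x_1,\dots,x_n]$ is generic over $F$ if it is a linear combination of all monomials of degree $d$ with coefficients algebraically independent over $F$. A homogeneous ideal $(f_1,\dots,f_r)$ is a generic homogeneous ideal of type $(n;d_1,\dots,d_r)$ if $f_1,\dots,f_r\in K[x_1,\dots,x_n]$ are generic forms of degrees $d_1,\dots,d_r$ such that all the coefficients of all the $f_i$ taken together are algebraically independent over $F$. Initial ideals $\operatorname{in}(\cdot)$ are taken with respect to the degree reverse lexicographic order with $x_1>\cdots>x_n$; minimal generators of $\operatorname{in}(I)$ are its minimal monomial generators. For a monomial $x^\alpha$, $\max(x^\alpha)$ is the largest index $i$ such that $x_i$ divides $x^\alpha$. *)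

theory Defs
  imports "HOL-Library.Poly_Mapping"
begin

text \<open>
  Polynomials are finitely supported functions from exponent vectors to coefficients, with the
  convolution product of \<^theory>\<open>HOL-Library.Poly_Mapping\<close>. The type of exponent vectors has
  infinitely many variables \<open>x\<^sub>i\<close> (\<open>i :: nat\<close>); the ring \<open>K[x\<^sub>1,\<dots>,x\<^sub>n]\<close> is the explicit carrier
  \<open>poly_ring n\<close>, so that \<open>n\<close> can be an ordinary variable.
\<close>

type_synonym expvec = "nat \<Rightarrow>\<^sub>0 nat"
type_synonym 'k mvpoly = "expvec \<Rightarrow>\<^sub>0 'k"

definition monomials_in :: "nat set \<Rightarrow> expvec set" where
  "monomials_in V = {\<alpha>. Poly_Mapping.keys \<alpha> \<subseteq> V}"

definition mon_deg :: "expvec \<Rightarrow> nat" where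
  "mon_deg \<alpha> = (\<Sum>i\<in>Poly_Mapping.keys \<alpha>. Poly_Mapping.lookup \<alpha> i)"

definition monomials_in_deg :: "nat set \<Rightarrow> nat \<Rightarrow> expvec set" where
  "monomials_in_deg V d = {\<alpha> \<in> monomials_in V. mon_deg \<alpha> = d}"

definition xpow :: "expvec \<Rightarrow> 'k::field mvpoly" where
  "xpow \<alpha> = Poly_Mapping.single \<alpha> 1"

text \<open>The value is only meaningful for \<open>\<alpha> \<noteq> 0\<close>; the monomial \<open>1\<close> has no largest index.\<close>

definition max_index :: "expvec \<Rightarrow> nat" where
  "max_index \<alpha> = Max (Poly_Mapping.keys \<alpha>)"

definition poly_ring :: "nat \<Rightarrow> 'k::field mvpoly set" where
  "poly_ring n = {p. Poly_Mapping.keys p \<subseteq> monomials_in {1..n}}"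

definition poly_ideal :: "nat \<Rightarrow> 'k::field mvpoly set \<Rightarrow> 'k mvpoly set" where
  "poly_ideal n S =
     {p. \<exists>T q. finite T \<and> T \<subseteq> S \<and> (\<forall>t\<in>T. q t \<in> poly_ring n) \<and> p = (\<Sum>t\<in>T. q t * t)}"

definition is_subfield :: "'k::field set \<Rightarrow> bool" where
  "is_subfield F \<longleftrightarrow> 0 \<in> F \<and> 1 \<in> F \<and>
     (\<forall>a\<in>F. \<forall>b\<in>F. a - b \<in> F \<and> a * b \<in> F) \<and> (\<forall>a\<in>F. inverse a \<in> F)"

definition eval_at :: "('j \<Rightarrow> 'k) \<Rightarrow> (('j \<Rightarrow>\<^sub>0 nat) \<Rightarrow>\<^sub>0 'k::field) \<Rightarrow> 'k" where
  "eval_at c P = (\<Sum>m\<in>Poly_Mapping.keys P.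
     Poly_Mapping.lookup P m * (\<Prod>j\<in>Poly_Mapping.keys m. c j ^ Poly_Mapping.lookup m j))"

text \<open>
  Independence of the indexed family \<open>(c j)\<close>, \<open>j \<in> J\<close> (in particular its members are distinct):
  no nonzero polynomial in the variables \<open>J\<close> with coefficients in \<open>F\<close> vanishes at \<open>c\<close>.
\<close>

definition alg_indep_family :: "'k::field set \<Rightarrow> 'j set \<Rightarrow> ('j \<Rightarrow> 'k) \<Rightarrow> bool" where
  "alg_indep_family F J c \<longleftrightarrow>
     (\<forall>P :: ('j \<Rightarrow>\<^sub>0 nat) \<Rightarrow>\<^sub>0 'k.
        (\<forall>m. Poly_Mapping.lookup P m \<in> F) \<and>
        (\<forall>m\<in>Poly_Mapping.keys P. Poly_Mapping.keys m \<subseteq> J) \<and>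
        eval_at c P = 0 \<longrightarrow> P = 0)"

definition generic_form :: "'k::field set \<Rightarrow> nat \<Rightarrow> nat \<Rightarrow> 'k mvpoly \<Rightarrow> bool" where
  "generic_form F n d p \<longleftrightarrow>
     Poly_Mapping.keys p \<subseteq> monomials_in_deg {1..n} d \<and>
     alg_indep_family F (monomials_in_deg {1..n} d) (Poly_Mapping.lookup p)"

text \<open>
  \<open>f 1, \<dots>, f r\<close> are generic forms of degrees \<open>d 1, \<dots>, d r\<close> in \<open>K[x\<^sub>1,\<dots>,x\<^sub>n]\<close> all of whose
  coefficients together form one algebraically independent family, indexed by pairs of the
  number of the form and a monomial.
\<close>

definition generic_forms ::
  "'k::field set \<Rightarrow> nat \<Rightarrow> nat \<Rightarrow> (nat \<Rightarrow> nat) \<Rightarrow> (nat \<Rightarrow> 'k mvpoly) \<Rightarrow> bool" where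
  "generic_forms F n r d f \<longleftrightarrow>
     (\<forall>i\<in>{1..r}. generic_form F n (d i) (f i)) \<and>
     alg_indep_family F (SIGMA i:{1..r}. monomials_in_deg {1..n} (d i))
       (\<lambda>(i, \<alpha>). Poly_Mapping.lookup (f i) \<alpha>)"

definition generic_homogeneous_ideal ::
  "'k::field set \<Rightarrow> nat \<Rightarrow> nat \<Rightarrow> (nat \<Rightarrow> nat) \<Rightarrow> 'k mvpoly set \<Rightarrow> bool" where
  "generic_homogeneous_ideal F n r d I \<longleftrightarrow>
     (\<exists>f. generic_forms F n r d f \<and> I = poly_ideal n (f ` {1..r}))"

text \<open>Degree reverse lexicographic order with \<open>x\<^sub>1 > x\<^sub>2 > \<dots>\<close>.\<close>

definition drl_less :: "expvec \<Rightarrow> expvec \<Rightarrow> bool" where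
  "drl_less \<alpha> \<beta> \<longleftrightarrow> mon_deg \<alpha> < mon_deg \<beta> \<or>
     (mon_deg \<alpha> = mon_deg \<beta> \<and>
      (\<exists>i. Poly_Mapping.lookup \<alpha> i > Poly_Mapping.lookup \<beta> i \<and>
         (\<forall>j>i. Poly_Mapping.lookup \<alpha> j = Poly_Mapping.lookup \<beta> j)))"

definition lead_expvec :: "'k::field mvpoly \<Rightarrow> expvec" where
  "lead_expvec p = 
     (THE \<alpha>. \<alpha> \<in> Poly_Mapping.keys p \<and>
        (\<forall>\<beta>\<in>Poly_Mapping.keys p. \<beta> \<noteq> \<alpha> \<longrightarrow> drl_less \<beta> \<alpha>))"

definition initial_ideal :: "nat \<Rightarrow> 'k::field mvpoly set \<Rightarrow> 'k mvpoly set" where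
  "initial_ideal n I = poly_ideal n {xpow (lead_expvec p) | p. p \<in> I \<and> p \<noteq> 0}"

text \<open>
  \<open>x\<^sup>\<mu>\<close> is a minimal monomial generator of the monomial ideal \<open>J\<close> of \<open>K[x\<^sub>1,\<dots>,x\<^sub>n]\<close>: it lies
  in \<open>J\<close> and no proper divisor of it does.
\<close>

definition minimal_generator :: "nat \<Rightarrow> 'k::field mvpoly set \<Rightarrow> expvec \<Rightarrow> bool" where
  "minimal_generator n J \<mu> \<longleftrightarrow>
     \<mu> \<in> monomials_in {1..n} \<and> xpow \<mu> \<in> J \<and>
     (\<forall>\<beta> \<gamma>. \<mu> = \<beta> + \<gamma> \<and> \<gamma> \<noteq> 0 \<longrightarrow> xpow \<beta> \<notin> J)"

definition pardue_conjecture_holds :: "nat \<Rightarrow> 'k::field mvpoly set \<Rightarrow> bool" where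
  "pardue_conjecture_holds n I \<longleftrightarrow>
     (\<forall>\<mu> m d. minimal_generator n (initial_ideal n I) \<mu> \<and> max_index \<mu> = m \<and> mon_deg \<mu> = d \<longrightarrow>
        (\<forall>\<nu>\<in>monomials_in_deg {1..<m} d. xpow \<nu> \<in> initial_ideal n I))"

lemma drl_less_linear: "drl_less \<alpha> \<beta> \<or> \<alpha> = \<beta> \<or> drl_less \<beta> \<alpha>"
proof (cases "\<alpha> = \<beta>")
  case False
  define D where "D = {i. Poly_Mapping.lookup \<alpha> i \<noteq> Poly_Mapping.lookup \<beta> i}"
  have "D \<subseteq> Poly_Mapping.keys \<alpha> \<union> Poly_Mapping.keys \<beta>"
    unfolding D_def by (auto simp: in_keys_iff)
  then have fin: "finite D"
    by (rule finite_subset) simp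
  have "D \<noteq> {}"
    using False poly_mapping_eqI[of \<alpha> \<beta>] unfolding D_def by blast
  then have "Max D \<in> D"
    using fin by simp
  moreover have "Poly_Mapping.lookup \<alpha> j = Poly_Mapping.lookup \<beta> j" if "j > Max D" for j
    using Max_ge[OF fin, of j] that unfolding D_def mem_Collect_eq by linarith
  ultimately have
    "\<exists>i. Poly_Mapping.lookup \<alpha> i \<noteq> Poly_Mapping.lookup \<beta> i \<and>
      (\<forall>j>i. Poly_Mapping.lookup \<alpha> j = Poly_Mapping.lookup \<beta> j)"
    unfolding D_def mem_Collect_eq by blast
  then obtain i where i: "Poly_Mapping.lookup \<alpha> i \<noteq> Poly_Mapping.lookup \<beta> i"
    "\<forall>j>i. Poly_Mapping.lookup \<alpha> j = Poly_Mapping.lookup \<beta> j"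
    by blast
  then consider "Poly_Mapping.lookup \<alpha> i < Poly_Mapping.lookup \<beta> i"
    | "Poly_Mapping.lookup \<beta> i < Poly_Mapping.lookup \<alpha> i"
    by linarith
  then show ?thesis
    unfolding drl_less_def using i(2) by (metis linorder_neqE)
qed simp

lemma drl_less_irrefl: "\<not> drl_less \<alpha> \<alpha>"
  by (simp add: drl_less_def)

lemma drl_less_trans:
  assumes "drl_less \<alpha> \<beta>" "drl_less \<beta> \<gamma>"
  shows "drl_less \<alpha> \<gamma>"
proof (cases "mon_deg \<alpha> = mon_deg \<beta> \<and> mon_deg \<beta> = mon_deg \<gamma>")
  case True
  obtain i where i: "Poly_Mapping.lookup \<alpha> i > Poly_Mapping.lookup \<beta> i"
      "\<forall>j>i. Poly_Mapping.lookup \<alpha> j = Poly_Mapping.lookup \<beta> j"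
    using assms(1) True unfolding drl_less_def by (metis less_irrefl)
  obtain k where k: "Poly_Mapping.lookup \<beta> k > Poly_Mapping.lookup \<gamma> k"
      "\<forall>j>k. Poly_Mapping.lookup \<beta> j = Poly_Mapping.lookup \<gamma> j"
    using assms(2) True unfolding drl_less_def by (metis less_irrefl)
  have "Poly_Mapping.lookup \<alpha> (max i k) > Poly_Mapping.lookup \<gamma> (max i k)"
  proof (cases "i < k")
    case True
    then show ?thesis
      using i(2) k(1) by (metis less_imp_le max_absorb2)
  next
    case False
    then have "Poly_Mapping.lookup \<gamma> i \<le> Poly_Mapping.lookup \<beta> i"
      using k by (metis less_imp_le nat_neq_iff order_refl)
    then show ?thesis
      using i(1) False by (simp add: max_absorb1)
  qed
  moreover have "\<forall>j>max i k. Poly_Mapping.lookup \<alpha> j = Poly_Mapping.lookup \<gamma> j"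
    using i(2) k(2) by (metis max_less_iff_conj)
  ultimately show ?thesis
    unfolding drl_less_def using True by metis
next
  case False
  then show ?thesis
    using assms by (auto simp: drl_less_def)
qed

lemma lead_expvec_unique_exists:
  assumes "p \<noteq> 0"
  shows "\<exists>!\<alpha>. \<alpha> \<in> Poly_Mapping.keys p \<and>
    (\<forall>\<beta>\<in>Poly_Mapping.keys p. \<beta> \<noteq> \<alpha> \<longrightarrow> drl_less \<beta> \<alpha>)"
proof -
  have ex: "\<exists>\<alpha>\<in>A. \<forall>\<beta>\<in>A. \<beta> \<noteq> \<alpha> \<longrightarrow> drl_less \<beta> \<alpha>" if "finite A" "A \<noteq> {}" for A
    using that
  proof (induction A rule: finite_ne_induct)
    case (insert x A)
    then obtain a where a: "a \<in> A" "\<forall>\<beta>\<in>A. \<beta> \<noteq> a \<longrightarrow> drl_less \<beta> a"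
      by blast
    show ?case
    proof (cases "drl_less x a")
      case True
      then show ?thesis
        using a by blast
    next
      case False
      then have "drl_less a x"
        using drl_less_linear[of a x] a(1) insert.hyps by auto
      then have "\<forall>\<beta>\<in>insert x A. \<beta> \<noteq> x \<longrightarrow> drl_less \<beta> x"
        using a drl_less_trans[of _ a x] by auto
      then show ?thesis
        by blast
    qed
  qed simp
  have "Poly_Mapping.keys p \<noteq> {}"
    using assms by simp
  from ex[OF finite_keys this] obtain \<alpha>
    where \<alpha>: "\<alpha> \<in> Poly_Mapping.keys p"
      "\<forall>\<beta>\<in>Poly_Mapping.keys p. \<beta> \<noteq> \<alpha> \<longrightarrow> drl_less \<beta> \<alpha>"
    by blast
  show ?thesis
  proof (rule ex1I[of _ \<alpha>])
    fix \<gamma>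
    assume \<gamma>: "\<gamma> \<in> Poly_Mapping.keys p \<and>
      (\<forall>\<beta>\<in>Poly_Mapping.keys p. \<beta> \<noteq> \<gamma> \<longrightarrow> drl_less \<beta> \<gamma>)"
    show "\<gamma> = \<alpha>"
    proof (rule ccontr)
      assume "\<gamma> \<noteq> \<alpha>"
      then have "drl_less \<gamma> \<alpha>" "drl_less \<alpha> \<gamma>"
        using \<alpha> \<gamma> by auto
      then show False
        using drl_less_trans drl_less_irrefl by blast
    qed
  qed (use \<alpha> in blast)
qed

end

theory Submission
  imports Defs "Jordan_Normal_Form.Determinant"
begin

text \<open>
  Modulo \<open>x\<^sub>3\<close> the part of degree \<open>D\<close> of the ideal is the image of the linear map
  \<open>(p\<^sub>1, p\<^sub>2, p\<^sub>3) \<mapsto> p\<^sub>1 f\<^sub>1 + p\<^sub>2 f\<^sub>2 + p\<^sub>3 f\<^sub>3\<close> of forms in \<open>x\<^sub>1, x\<^sub>2\<close>. If it is surjective, every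
  monomial of degree \<open>D\<close> in \<open>x\<^sub>1, x\<^sub>2\<close> is an initial monomial; if it is injective, then an element of
  the ideal whose leading monomial has degree \<open>D\<close> and involves \<open>x\<^sub>3\<close> can be divided by \<open>x\<^sub>3\<close> inside the
  ideal, so that this monomial is no minimal generator. The map has maximal rank because it has
  maximal rank after specializing \<open>f\<^sub>1, f\<^sub>2, f\<^sub>3\<close> to the monomials \<open>x\<^sub>1\<^sup>d\<^sup>1\<close>, \<open>x\<^sub>2\<^sup>d\<^sup>2\<close> and
  \<open>x\<^sub>1\<^sup>k x\<^sub>2\<^sup>d\<^sup>3\<^sup>-\<^sup>k\<close> with \<open>k = D + 1 - d\<^sub>2\<close>: in degrees where \<open>f\<^sub>3\<close> matters, the multiples of the first two
  miss exactly the exponents \<open>k, \<dots>, d\<^sub>1 - 1\<close> of \<open>x\<^sub>1\<close>, and those of the third fill an interval starting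
  at \<open>k\<close>. This works in every characteristic.
\<close>

abbreviation lookup :: "('a \<Rightarrow>\<^sub>0 'b::zero) \<Rightarrow> 'a \<Rightarrow> 'b" where
  "lookup \<equiv> Poly_Mapping.lookup"

abbreviation keys :: "('a \<Rightarrow>\<^sub>0 'b::zero) \<Rightarrow> 'a set" where
  "keys \<equiv> Poly_Mapping.keys"

section \<open>Determinants in algebraically independent quantities\<close>

text \<open>The monomial factor of \<open>eval_at\<close>, split off so that sums and products can
  be taken over any common finite superset of the supports.\<close>

definition mon_eval :: "('j \<Rightarrow> 'k::field) \<Rightarrow> ('j \<Rightarrow>\<^sub>0 nat) \<Rightarrow> 'k" where
  "mon_eval c m = (\<Prod>j\<in>keys m. c j ^ lookup m j)"

lemma mon_eval_superset:
  assumes "finite A" "keys m \<subseteq> A"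
  shows "mon_eval c m = (\<Prod>j\<in>A. c j ^ lookup m j)"
  unfolding mon_eval_def
  by (rule prod.mono_neutral_left) (use assms in \<open>auto simp: in_keys_iff\<close>)

lemma mon_eval_0 [simp]: "mon_eval c 0 = 1"
  by (simp add: mon_eval_def)

lemma mon_eval_add: "mon_eval c (m + m') = mon_eval c m * mon_eval c m'"
proof -
  let ?A = "keys m \<union> keys m'"
  have "mon_eval c (m + m') = (\<Prod>j\<in>?A. c j ^ lookup (m + m') j)"
    by (rule mon_eval_superset) (use keys_add[of m m'] in auto)
  also have "\<dots> = (\<Prod>j\<in>?A. c j ^ lookup m j) * (\<Prod>j\<in>?A. c j ^ lookup m' j)"
    by (simp add: lookup_add power_add prod.distrib)
  also have "\<dots> = mon_eval c m * mon_eval c m'"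
    by (simp add: mon_eval_superset[of ?A])
  finally show ?thesis .
qed

lemma mon_eval_sum_single:
  "finite A \<Longrightarrow> mon_eval c (\<Sum>k\<in>A. Poly_Mapping.single (j k) 1) = (\<Prod>k\<in>A. c (j k))"
  by (induction A rule: finite_induct) (auto simp: mon_eval_add, simp add: mon_eval_def)

lemma eval_at_superset:
  assumes "finite A" "keys P \<subseteq> A"
  shows "eval_at c P = (\<Sum>m\<in>A. lookup P m * mon_eval c m)"
  unfolding eval_at_def mon_eval_def
  by (rule sum.mono_neutral_left) (use assms in \<open>auto simp: in_keys_iff\<close>)

lemma eval_at_0 [simp]: "eval_at c 0 = 0"
  by (simp add: eval_at_def)

lemma eval_at_add: "eval_at c (P + Q) = eval_at c P + eval_at c Q"
proof -
  let ?A = "keys P \<union> keys Q"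
  have "eval_at c (P + Q) = (\<Sum>m\<in>?A. lookup (P + Q) m * mon_eval c m)"
    by (rule eval_at_superset) (use keys_add[of P Q] in auto)
  also have "\<dots> = (\<Sum>m\<in>?A. lookup P m * mon_eval c m) + (\<Sum>m\<in>?A. lookup Q m * mon_eval c m)"
    by (simp add: lookup_add algebra_simps sum.distrib)
  also have "\<dots> = eval_at c P + eval_at c Q"
    by (simp add: eval_at_superset[of ?A])
  finally show ?thesis .
qed

lemma eval_at_sum: "eval_at c (\<Sum>i\<in>A. P i) = (\<Sum>i\<in>A. eval_at c (P i))"
  by (induction A rule: infinite_finite_induct) (auto simp: eval_at_add)

lemma eval_at_single: "eval_at c (Poly_Mapping.single m a) = a * mon_eval c m"
  by (subst eval_at_superset[of "{m}"]) auto

lemma subfield_sum: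
  assumes "is_subfield F" "\<And>i. i \<in> A \<Longrightarrow> g i \<in> F"
  shows "(\<Sum>i\<in>A. g i) \<in> F"
proof -
  have add: "a + b \<in> F" if "a \<in> F" "b \<in> F" for a b
  proof -
    have "0 - b \<in> F"
      using assms(1) that unfolding is_subfield_def by blast
    then have "a - (0 - b) \<in> F"
      using assms(1) that unfolding is_subfield_def by blast
    then show ?thesis
      by simp
  qed
  have "0 \<in> F"
    using assms(1) by (simp add: is_subfield_def)
  then show ?thesis
    using assms(2) by (induction A rule: infinite_finite_induct) (simp_all add: add)
qed

lemma subfield_signof: "is_subfield F \<Longrightarrow> signof p \<in> F"
proof -
  assume F: "is_subfield F"
  then have "0 - 1 \<in> F"
    unfolding is_subfield_def by blast
  moreover have "1 \<in> F"
    using F by (simp add: is_subfield_def)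
  ultimately show ?thesis
    by (simp add: sign_def)
qed

text \<open>An entry of the matrices below is zero or a single variable: \<open>None\<close> encodes
  zero under every assignment, \<open>Some j\<close> the variable \<open>j\<close>. One variable may
  occur in several places.\<close>

abbreviation entry :: "('j \<Rightarrow> 'k::field) \<Rightarrow> 'j option \<Rightarrow> 'k" where
  "entry c \<equiv> case_option 0 c"

text \<open>The determinant is the value of a single polynomial \<open>Q\<close> over
  \<open>F\<close>. If it vanished at the independent family \<open>c\<close>, then \<open>Q\<close>
  would be zero and the determinant would vanish at \<open>s\<close> too.\<close>

lemma alg_indep_det:
  fixes c s :: "'j \<Rightarrow> 'k::field"
  assumes F: "is_subfield F" and c: "alg_indep_family F J c"
    and J: "\<And>k l j. \<lbrakk>k < N; l < N; e k l = Some j\<rbrakk> \<Longrightarrow> j \<in> J"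
    and s: "det (mat N N (\<lambda>(k, l). entry s (e k l))) \<noteq> 0"
  shows "det (mat N N (\<lambda>(k, l). entry c (e k l))) \<noteq> 0"
proof
  let ?M = "\<lambda>t :: 'j \<Rightarrow> 'k. mat N N (\<lambda>(k, l). entry t (e k l))"
  \<comment> \<open>Leibniz expansion: a permutation that meets a \<open>None\<close> entry
    contributes nothing, every other one its sign times a product of variables.\<close>
  let ?ok = "\<lambda>p. \<forall>k\<in>{0..<N}. e k (p k) \<noteq> None"
  let ?mon = "\<lambda>p. (\<Sum>k\<in>{0..<N}. Poly_Mapping.single (the (e k (p k))) (1::nat))"
  let ?T = "\<lambda>p. if ?ok p then Poly_Mapping.single (?mon p) (signof p :: 'k) else 0"
  define Q where "Q = (\<Sum>p\<in>{p. p permutes {0..<N}}. ?T p)"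
  have evQ: "eval_at t Q = det (?M t)" for t
  proof -
    have T: "eval_at t (?T p) = signof p * (\<Prod>k = 0..<N. ?M t $$ (k, p k))"
      if p: "p permutes {0..<N}" for p
    proof (cases "?ok p")
      case True
      have "(\<Prod>k = 0..<N. ?M t $$ (k, p k)) = (\<Prod>k = 0..<N. t (the (e k (p k))))"
      proof (rule prod.cong[OF refl])
        fix k assume k: "k \<in> {0..<N}"
        then have "p k < N"
          using permutes_in_image[OF p, of k] by auto
        moreover obtain j where "e k (p k) = Some j"
          using bspec[OF True k] by blast
        ultimately show "?M t $$ (k, p k) = t (the (e k (p k)))"
          using k by auto
      qed
      then show ?thesis
        using True by (simp add: eval_at_single mon_eval_sum_single del: One_nat_def)
    next
      case False
      then obtain k where k: "k \<in> {0..<N}" "e k (p k) = None"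
        by auto
      then have "p k < N"
        using permutes_in_image[OF p, of k] by auto
      then have "?M t $$ (k, p k) = 0"
        using k by auto
      then have "(\<Prod>k = 0..<N. ?M t $$ (k, p k)) = 0"
        using k(1) by (intro prod_zero) auto
      then show ?thesis
        by (simp only: if_not_P[OF False] eval_at_0 mult_zero_right)
    qed
    have "eval_at t Q = (\<Sum>p\<in>{p. p permutes {0..<N}}. signof p * (\<Prod>k = 0..<N. ?M t $$ (k, p k)))"
      unfolding Q_def eval_at_sum by (rule sum.cong[OF refl T]) (simp only: mem_Collect_eq)
    also have "\<dots> = det (?M t)"
      by (rule det_def'[symmetric]) simp
    finally show ?thesis .
  qed
  assume "det (mat N N (\<lambda>(k, l). entry c (e k l))) = 0"
  then have "eval_at c Q = 0"
    by (simp add: evQ)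
  \<comment> \<open>Distinct permutations may yield the same monomial, so a coefficient of
    \<open>Q\<close> is a sum of signs.\<close>
  moreover have "lookup Q m \<in> F" for m
  proof -
    have "0 \<in> F"
      using F by (simp add: is_subfield_def)
    then show ?thesis
      unfolding Q_def lookup_sum
      by (intro subfield_sum[OF F]) (simp add: lookup_single when_def subfield_signof[OF F])
  qed
  moreover have "keys m \<subseteq> J" if m: "m \<in> keys Q" for m
  proof
    fix j assume j: "j \<in> keys m"
    obtain p where p: "p permutes {0..<N}" "m \<in> keys (?T p)"
      using subsetD[OF keys_sum m[unfolded Q_def]] by (elim UN_E) simp
    then have ok: "?ok p" and "m = ?mon p"
      by (auto split: if_splits)
    then obtain k where k: "k \<in> {0..<N}" "j = the (e k (p k))"
      using j keys_sum[of "\<lambda>k. Poly_Mapping.single (the (e k (p k))) (1::nat)" "{0..<N}"] by auto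
    then have "p k < N"
      using permutes_in_image[OF p(1), of k] by auto
    then show "j \<in> J"
      using J[of k "p k" j] k ok by auto
  qed
  ultimately have "Q = 0"
    using c[unfolded alg_indep_family_def, THEN spec, of Q] by simp
  then show False
    using s evQ[of s] by simp
qed

text \<open>Injectivity and solvability of a square system with nonzero determinant, phrased with
  sums over \<open>X\<close> so that the enumeration \<open>h\<close> stays out of the arguments
  about polynomials.\<close>

lemma nonsingular_set_indexed:
  fixes M :: "'x \<Rightarrow> 'x \<Rightarrow> 'k::field"
  assumes h: "bij_betw h {0..<N} X"
    and det: "det (mat N N (\<lambda>(k, l). M (h k) (h l))) \<noteq> 0"
  shows "\<And>v. (\<And>x. x \<in> X \<Longrightarrow> (\<Sum>y\<in>X. M x y * v y) = 0) \<Longrightarrow> (\<And>x. x \<in> X \<Longrightarrow> v x = 0)"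
    and "\<And>x0. \<exists>v. \<forall>x\<in>X. (\<Sum>y\<in>X. M x y * v y) = (if x = x0 then 1 else 0)"
proof -
  let ?A = "mat N N (\<lambda>(k, l). M (h k) (h l))"
  have A: "?A \<in> carrier_mat N N"
    by simp
  have mv: "(?A *\<^sub>v w) $ k = (\<Sum>y\<in>X. M (h k) y * w $ (inv_into {0..<N} h y))"
    if "w \<in> carrier_vec N" "k < N" for w k
  proof -
    have "(?A *\<^sub>v w) $ k = (\<Sum>l = 0..<N. M (h k) (h l) * w $ l)"
      using that by (simp add: scalar_prod_def)
    also have "\<dots> = (\<Sum>l = 0..<N. M (h k) (h l) * w $ (inv_into {0..<N} h (h l)))"
      using h by (intro sum.cong) (auto simp: bij_betw_def)
    also have "\<dots> = (\<Sum>y\<in>X. M (h k) y * w $ (inv_into {0..<N} h y))"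
      by (rule sum.reindex_bij_betw[OF h])
    finally show ?thesis .
  qed
  show "v x = 0" if v: "\<And>x. x \<in> X \<Longrightarrow> (\<Sum>y\<in>X. M x y * v y) = 0" and x: "x \<in> X" for v x
  proof -
    let ?w = "vec N (\<lambda>l. v (h l))"
    have inv: "h (inv_into {0..<N} h y) = y" "inv_into {0..<N} h y < N" if "y \<in> X" for y
      using h that bij_betw_inv_into_right[OF h that] bij_betw_apply[OF bij_betw_inv_into[OF h] that]
      by auto
    have "?A *\<^sub>v ?w = 0\<^sub>v N"
    proof (rule eq_vecI)
      fix k assume k: "k < dim_vec (0\<^sub>v N :: 'k vec)"
      have "(?A *\<^sub>v ?w) $ k = (\<Sum>y\<in>X. M (h k) y * ?w $ (inv_into {0..<N} h y))"
        using k by (intro mv) auto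
      also have "\<dots> = (\<Sum>y\<in>X. M (h k) y * v y)"
        by (rule sum.cong) (auto simp: inv)
      also have "\<dots> = 0"
        using v k bij_betw_apply[OF h] by auto
      finally show "(?A *\<^sub>v ?w) $ k = 0\<^sub>v N $ k"
        using k by simp
    qed simp
    then have "?w = 0\<^sub>v N"
      using det det_0_iff_vec_prod_zero_field[OF A] vec_carrier[of N] by blast
    then have "?w $ (inv_into {0..<N} h x) = 0"
      using inv[OF x] by simp
    then show ?thesis
      using inv[OF x] by simp
  qed
  show "\<exists>v. \<forall>x\<in>X. (\<Sum>y\<in>X. M x y * v y) = (if x = x0 then 1 else 0)" for x0
  proof -
    \<comment> \<open>The column of the inverse matrix \<open>B\<close> that belongs to
      \<open>x0\<close> is the solution; for \<open>x0\<close> outside \<open>X\<close> the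
      right-hand side is zero.\<close>
    obtain B where B: "B \<in> carrier_mat N N" "?A * B = 1\<^sub>m N"
      using det_non_zero_imp_unit[OF A det, of "()"] unfolding Units_def ring_mat_def by auto
    let ?e = "vec N (\<lambda>k. if h k = x0 then 1 else (0::'k))"
    have w: "?A *\<^sub>v (B *\<^sub>v ?e) = ?e"
      using B assoc_mult_mat_vec[OF A B(1), of ?e] by simp
    have Bc: "B *\<^sub>v ?e \<in> carrier_vec N"
      using B by simp
    have "(\<Sum>y\<in>X. M x y * (B *\<^sub>v ?e) $ (inv_into {0..<N} h y)) = (if x = x0 then 1 else 0)"
      if "x \<in> X" for x
    proof -
      have "x \<in> h ` {0..<N}"
        using that h by (simp add: bij_betw_def)
      then obtain k where k: "k < N" "x = h k"
        by auto
      show ?thesis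
        using mv[OF Bc k(1)] k unfolding w by simp
    qed
    then show ?thesis
      by (intro exI[of _ "\<lambda>y. (B *\<^sub>v ?e) $ (inv_into {0..<N} h y)"]) simp
  qed
qed

text \<open>Assigning 1 to the variables in \<open>S\<close> and 0 to all others turns the matrix
  into the identity, by the last hypothesis; a nonzero determinant there forces one at
  \<open>c\<close>.\<close>

lemma alg_indep_nonsingular:
  fixes c :: "'j \<Rightarrow> 'k::field" and e :: "'x \<Rightarrow> 'x \<Rightarrow> 'j option"
  assumes F: "is_subfield F" and c: "alg_indep_family F J c"
    and J: "\<And>x y j. \<lbrakk>x \<in> X; y \<in> X; e x y = Some j\<rbrakk> \<Longrightarrow> j \<in> J"
    and X: "finite X"
    and S: "\<And>x y. \<lbrakk>x \<in> X; y \<in> X\<rbrakk> \<Longrightarrow> (\<exists>j\<in>S. e x y = Some j) \<longleftrightarrow> x = y"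
  shows "\<And>v. (\<And>x. x \<in> X \<Longrightarrow> (\<Sum>y\<in>X. entry c (e x y) * v y) = 0) \<Longrightarrow> (\<And>x. x \<in> X \<Longrightarrow> v x = 0)"
    and "\<And>x0. \<exists>v. \<forall>x\<in>X. (\<Sum>y\<in>X. entry c (e x y) * v y) = (if x = x0 then 1 else 0)"
proof -
  obtain h where h: "bij_betw h {0..<card X} X"
    using ex_bij_betw_nat_finite[OF X] by blast
  define s :: "'j \<Rightarrow> 'k" where "s j = (if j \<in> S then 1 else 0)" for j
  let ?N = "card X"
  have hX: "h k \<in> X" if "k < ?N" for k
    using bij_betw_apply[OF h] that by auto
  have "entry s (e (h k) (h l)) = (if k = l then 1 else 0)" if "k < ?N" "l < ?N" for k l
  proof -
    have "h k = h l \<longleftrightarrow> k = l"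
      using h that by (auto simp: bij_betw_def inj_on_def)
    then show ?thesis
      using S[OF hX[OF that(1)] hX[OF that(2)]] by (auto simp: s_def split: option.split)
  qed
  then have "mat ?N ?N (\<lambda>(k, l). entry s (e (h k) (h l))) = 1\<^sub>m ?N"
    by (intro eq_matI) auto
  then have "det (mat ?N ?N (\<lambda>(k, l). entry s (e (h k) (h l)))) \<noteq> 0"
    by (simp only: det_one) simp
  then have det: "det (mat ?N ?N (\<lambda>(k, l). entry c (e (h k) (h l)))) \<noteq> 0"
    by (rule alg_indep_det[OF F c, rotated]) (use J hX in blast)
  show "\<And>v. (\<And>x. x \<in> X \<Longrightarrow> (\<Sum>y\<in>X. entry c (e x y) * v y) = 0) \<Longrightarrow> (\<And>x. x \<in> X \<Longrightarrow> v x = 0)"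
    by (rule nonsingular_set_indexed(1)[OF h det])
  show "\<And>x0. \<exists>v. \<forall>x\<in>X. (\<Sum>y\<in>X. entry c (e x y) * v y) = (if x = x0 then 1 else 0)"
    by (rule nonsingular_set_indexed(2)[OF h det])
qed

section \<open>Monomials and the degree reverse lexicographic order\<close>

lemma keys_add_nat: "keys (a + b :: 'a \<Rightarrow>\<^sub>0 nat) = keys a \<union> keys b"
  by (auto simp: in_keys_iff lookup_add)

lemma mon_deg_superset:
  assumes "finite A" "keys a \<subseteq> A"
  shows "mon_deg a = (\<Sum>i\<in>A. lookup a i)"
  unfolding mon_deg_def
  by (rule sum.mono_neutral_left) (use assms in \<open>auto simp: in_keys_iff\<close>)

lemma mon_deg_add: "mon_deg (a + b) = mon_deg a + mon_deg b"
  by (simp add: mon_deg_superset[of "keys a \<union> keys b"] keys_add_nat lookup_add sum.distrib)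

lemma mon_deg_single [simp]: "mon_deg (Poly_Mapping.single i e) = e"
  by (subst mon_deg_superset[of "{i}"]) auto

lemma mon_deg_0 [simp]: "mon_deg 0 = 0"
  by (simp add: mon_deg_def)

lemma mon_deg_eq_0_iff: "mon_deg a = 0 \<longleftrightarrow> a = 0"
proof
  assume "mon_deg a = 0"
  then have "lookup a i = 0" for i
    by (cases "i \<in> keys a") (auto simp: mon_deg_def in_keys_iff)
  then show "a = 0"
    by (intro poly_mapping_eqI) simp
qed simp

lemma monomials_in_add_iff: "a + b \<in> monomials_in V \<longleftrightarrow> a \<in> monomials_in V \<and> b \<in> monomials_in V"
  by (auto simp: monomials_in_def keys_add_nat)

lemma monomials_in_mono: "V \<subseteq> W \<Longrightarrow> monomials_in V \<subseteq> monomials_in W"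
  by (auto simp: monomials_in_def)

text \<open>An exponent vector is determined by its restriction to \<open>V\<close>, and no exponent
  exceeds the degree.\<close>

lemma finite_monomials_in_deg:
  assumes "finite V"
  shows "finite (monomials_in_deg V D)"
proof (rule inj_on_finite)
  let ?h = "\<lambda>a. restrict (lookup a) V"
  show "inj_on ?h (monomials_in_deg V D)"
  proof (rule inj_onI, rule poly_mapping_eqI)
    fix a b i
    assume a: "a \<in> monomials_in_deg V D" "b \<in> monomials_in_deg V D" "?h a = ?h b"
    show "lookup a i = lookup b i"
    proof (cases "i \<in> V")
      case True
      then show ?thesis
        using fun_cong[OF a(3), of i] by simp
    next
      case False
      then have "i \<notin> keys a" "i \<notin> keys b"
        using a by (auto simp: monomials_in_deg_def monomials_in_def)
      then show ?thesis
        by (simp add: in_keys_iff)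
    qed
  qed
  show "?h ` monomials_in_deg V D \<subseteq> V \<rightarrow>\<^sub>E {..D}"
  proof (rule image_subsetI, rule PiE_I)
    fix a i assume a: "a \<in> monomials_in_deg V D" "i \<in> V"
    then have "D = (\<Sum>i\<in>V. lookup a i)"
      using mon_deg_superset[OF assms, of a] by (auto simp: monomials_in_deg_def monomials_in_def)
    then show "?h a i \<in> {..D}"
      using member_le_sum[of i V "lookup a"] a assms by auto
  qed simp
  show "finite (V \<rightarrow>\<^sub>E {..D})"
    using assms by (intro finite_PiE) auto
qed

lemma drl_less_add_cancel: "drl_less (c + a) (c + b) \<longleftrightarrow> drl_less a b"
  by (simp add: drl_less_def mon_deg_add lookup_add)

text \<open>The comparison is decided at the largest index where the exponents differ, and the
  larger exponent there makes the smaller monomial. Hence, within one degree, the monomials that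
  survive modulo \<open>x\<^sub>m, \<dots>, x\<^sub>n\<close> dominate.\<close>

lemma drl_less_leaving_variables:
  assumes b: "b \<in> monomials_in {1..<m}" and b': "b' \<in> monomials_in {1..n}" "b' \<notin> monomials_in {1..<m}"
    and deg: "mon_deg b' = mon_deg b"
  shows "drl_less b' b"
proof -
  have "\<not> drl_less b b'"
  proof
    assume "drl_less b b'"
    then obtain i where i: "lookup b i > lookup b' i" "\<forall>j>i. lookup b j = lookup b' j"
      using deg unfolding drl_less_def by auto
    from i(1) have "i \<in> keys b"
      by (simp add: in_keys_iff)
    then have "i < m"
      using b by (auto simp: monomials_in_def)
    moreover obtain j where j: "j \<in> keys b'" "\<not> j < m"
      using b' by (fastforce simp: monomials_in_def)
    ultimately have "j \<in> keys b"
      using i(2) by (auto simp: in_keys_iff)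
    then show False
      using j b by (auto simp: monomials_in_def)
  qed
  then show ?thesis
    using drl_less_linear[of b b'] b b'(2) by auto
qed

text \<open>The exponent that makes \<open>b\<close> smaller sits at an index at most
  \<open>n\<close>: either at \<open>n\<close> itself, or \<open>a\<close> and \<open>b\<close>
  agree at \<open>n\<close>. This property of the order is what permits dividing by the last
  variable.\<close>

lemma drl_less_last_variable:
  assumes "drl_less b a" "mon_deg b = mon_deg a" "b \<in> monomials_in {1..n}" "n \<in> keys a"
  shows "n \<in> keys b"
proof -
  obtain i where i: "lookup b i > lookup a i" "\<forall>j>i. lookup b j = lookup a j"
    using assms(1,2) unfolding drl_less_def by auto
  from i(1) have "i \<in> keys b"
    by (simp add: in_keys_iff)
  then have "i \<le> n"
    using assms(3) by (auto simp: monomials_in_def)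
  then show ?thesis
    using i assms(4) \<open>i \<in> keys b\<close> by (cases "i = n") (auto simp: in_keys_iff)
qed

lemma lead_expvec_eqI:
  assumes "a \<in> keys p" "\<And>b. \<lbrakk>b \<in> keys p; b \<noteq> a\<rbrakk> \<Longrightarrow> drl_less b a"
  shows "lead_expvec p = a"
  unfolding lead_expvec_def
proof (rule the1_equality[OF lead_expvec_unique_exists])
  show "p \<noteq> 0"
    using assms(1) by auto
qed (use assms in blast)

lemma
  assumes "p \<noteq> 0"
  shows lead_expvec_in_keys: "lead_expvec p \<in> keys p"
    and lead_expvec_greatest: "\<lbrakk>b \<in> keys p; b \<noteq> lead_expvec p\<rbrakk> \<Longrightarrow> drl_less b (lead_expvec p)"
  using theI'[OF lead_expvec_unique_exists[OF assms]] unfolding lead_expvec_def by blast+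

section \<open>Polynomials and ideals\<close>

lemma lookup_single_times:
  fixes p :: "'k::field mvpoly"
  shows "lookup (Poly_Mapping.single g a * p) (g + b) = a * lookup p b"
  by (simp add: lookup_mult lookup_single when_mult)

lemma keys_xpow_times: "y \<in> keys (xpow g * p) \<Longrightarrow> \<exists>b\<in>keys p. y = g + b"
  using keys_mult[of "xpow g" p] by (auto simp: xpow_def)

lemma lookup_xpow_times: "lookup (xpow g * p) (g + b) = lookup p b"
  by (simp add: xpow_def lookup_single_times)

lemma single_eq_xpow: "Poly_Mapping.single g a = Poly_Mapping.single 0 a * xpow g"
  by (simp add: xpow_def mult_single)

lemma lookup_single_0_times: "lookup (Poly_Mapping.single 0 a * p) y = a * lookup p y"
  for p :: "'k::field mvpoly"
  using lookup_single_times[of 0 a p y] by simp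

lemma sum_single_keys: "(\<Sum>g\<in>keys q. Poly_Mapping.single g (lookup q g)) = q"
  by (rule poly_mapping_eqI) (auto simp: lookup_sum lookup_single when_def in_keys_iff)

lemma lookup_sum_single_times:
  fixes p :: "'k::field mvpoly"
  shows "lookup ((\<Sum>g\<in>A. Poly_Mapping.single g (a g)) * p) y = (\<Sum>g\<in>A. a g * lookup (xpow g * p) y)"
proof -
  have "lookup ((\<Sum>g\<in>A. Poly_Mapping.single g (a g)) * p) y
      = (\<Sum>g\<in>A. lookup (Poly_Mapping.single g (a g) * p) y)"
    by (simp add: sum_distrib_right lookup_sum)
  also have "\<dots> = (\<Sum>g\<in>A. a g * lookup (xpow g * p) y)"
    by (rule sum.cong[OF refl], subst single_eq_xpow, subst mult.assoc) (rule lookup_single_0_times)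
  finally show ?thesis .
qed

text \<open>Linear in the coefficients of \<open>q\<close>; the factors
  \<open>lookup (xpow g * p) y\<close> become the entries of the coefficient matrix of the
  multiples.\<close>

lemma lookup_times:
  fixes p :: "'k::field mvpoly"
  shows "lookup (q * p) y = (\<Sum>g\<in>keys q. lookup q g * lookup (xpow g * p) y)"
  using lookup_sum_single_times[where A = "keys q" and a = "lookup q"] by (simp add: sum_single_keys)

lemma poly_ring_0 [simp]: "0 \<in> poly_ring n"
  by (simp add: poly_ring_def)

lemma poly_ring_add: "p \<in> poly_ring n \<Longrightarrow> q \<in> poly_ring n \<Longrightarrow> p + q \<in> poly_ring n"
  using keys_add[of p q] by (auto simp: poly_ring_def)

lemma poly_ring_sum: "(\<And>i. i \<in> A \<Longrightarrow> p i \<in> poly_ring n) \<Longrightarrow> sum p A \<in> poly_ring n"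
  by (induction A rule: infinite_finite_induct) (auto simp: poly_ring_add)

lemma poly_ring_single: "g \<in> monomials_in {1..n} \<Longrightarrow> Poly_Mapping.single g a \<in> poly_ring n"
  by (auto simp: poly_ring_def)

text \<open>Allows cofactors indexed by the number of the form even when \<open>f\<close> takes a
  value twice. From left to right one index is chosen per generator; from right to left the
  cofactors of equal generators are added.\<close>

lemma poly_ideal_image_iff:
  assumes A: "finite A"
  shows "p \<in> poly_ideal n (f ` A) \<longleftrightarrow>
    (\<exists>q. (\<forall>i\<in>A. q i \<in> poly_ring n) \<and> p = (\<Sum>i\<in>A. q i * f i))"
proof
  assume "p \<in> poly_ideal n (f ` A)"
  then obtain T q where T: "finite T" "T \<subseteq> f ` A" "\<forall>t\<in>T. q t \<in> poly_ring n" "p = (\<Sum>t\<in>T. q t * t)"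
    unfolding poly_ideal_def by blast
  obtain B where B: "B \<subseteq> A" "inj_on f B" "T = f ` B"
    using T(2) by (meson subset_image_inj)
  let ?q = "\<lambda>i. if i \<in> B then q (f i) else 0"
  have "p = (\<Sum>i\<in>B. q (f i) * f i)"
    using T(4) B by (simp add: sum.reindex)
  also have "\<dots> = (\<Sum>i\<in>A. ?q i * f i)"
    using B(1) A by (intro sum.mono_neutral_cong_left) auto
  finally have "p = (\<Sum>i\<in>A. ?q i * f i)" .
  moreover have "\<forall>i\<in>A. ?q i \<in> poly_ring n"
    using T(3) B(3) by auto
  ultimately show "\<exists>q. (\<forall>i\<in>A. q i \<in> poly_ring n) \<and> p = (\<Sum>i\<in>A. q i * f i)"
    by (intro exI[of _ ?q] conjI)
next
  assume "\<exists>q. (\<forall>i\<in>A. q i \<in> poly_ring n) \<and> p = (\<Sum>i\<in>A. q i * f i)"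
  then obtain q where q: "\<forall>i\<in>A. q i \<in> poly_ring n" "p = (\<Sum>i\<in>A. q i * f i)"
    by blast
  let ?q = "\<lambda>t. \<Sum>i\<in>{i\<in>A. f i = t}. q i"
  have "p = (\<Sum>t\<in>f ` A. \<Sum>i\<in>{i\<in>A. f i = t}. q i * f i)"
    unfolding q(2) by (rule sum.image_gen[OF A])
  also have "\<dots> = (\<Sum>t\<in>f ` A. ?q t * t)"
    by (simp add: sum_distrib_right)
  finally have "p = (\<Sum>t\<in>f ` A. ?q t * t)" .
  moreover have "\<forall>t\<in>f ` A. ?q t \<in> poly_ring n"
    using q(1) by (auto intro!: poly_ring_sum)
  ultimately show "p \<in> poly_ideal n (f ` A)"
    unfolding poly_ideal_def using A by (intro CollectI exI[of _ "f ` A"] exI[of _ ?q]) auto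
qed

lemma poly_ideal_image_sum:
  assumes A: "finite A" and p: "\<And>x. x \<in> X \<Longrightarrow> p x \<in> poly_ideal n (f ` A)"
  shows "(\<Sum>x\<in>X. p x) \<in> poly_ideal n (f ` A)"
proof -
  have "\<exists>q. (\<forall>i\<in>A. q i \<in> poly_ring n) \<and> p x = (\<Sum>i\<in>A. q i * f i)" if "x \<in> X" for x
    using p[OF that] unfolding poly_ideal_image_iff[OF A] .
  then obtain q where q: "\<And>x i. x \<in> X \<Longrightarrow> i \<in> A \<Longrightarrow> q x i \<in> poly_ring n"
      "\<And>x. x \<in> X \<Longrightarrow> p x = (\<Sum>i\<in>A. q x i * f i)"
    by metis
  have "(\<Sum>x\<in>X. p x) = (\<Sum>x\<in>X. \<Sum>i\<in>A. q x i * f i)"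
    using q(2) by simp
  also have "\<dots> = (\<Sum>i\<in>A. (\<Sum>x\<in>X. q x i) * f i)"
    by (subst sum.swap) (simp add: sum_distrib_right)
  finally show ?thesis
    unfolding poly_ideal_image_iff[OF A] using q(1)
    by (intro exI[of _ "\<lambda>i. \<Sum>x\<in>X. q x i"]) (auto intro: poly_ring_sum)
qed

lemma poly_ideal_image_times:
  assumes A: "finite A" and "i \<in> A" "q \<in> poly_ring n"
  shows "q * f i \<in> poly_ideal n (f ` A)"
proof -
  have "q * f i = (\<Sum>j\<in>A. if j = i then q * f i else 0)"
    using assms by simp
  also have "\<dots> = (\<Sum>j\<in>A. (if j = i then q else 0) * f j)"
    by (rule sum.cong) auto
  finally show ?thesis
    unfolding poly_ideal_image_iff[OF A] using assms(3)
    by (intro exI[of _ "\<lambda>j. if j = i then q else 0"]) auto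
qed

lemma initial_ideal_leadI:
  assumes "p \<in> I" "p \<noteq> 0"
  shows "xpow (lead_expvec p) \<in> initial_ideal n I"
  unfolding initial_ideal_def poly_ideal_def
proof (intro CollectI exI[of _ "{xpow (lead_expvec p)}"] exI[of _ "\<lambda>_. 1"] conjI ballI)
  show "(1 :: 'a mvpoly) \<in> poly_ring n"
    by (simp add: poly_ring_def monomials_in_def)
qed (use assms in auto)

text \<open>A monomial that occurs in a sum occurs in one of its summands, so it is a multiple of a
  single leading monomial.\<close>

lemma initial_idealE:
  assumes "xpow a \<in> initial_ideal n (I :: 'k::field mvpoly set)"
  obtains p c where "p \<in> I" "p \<noteq> 0" "a = lead_expvec p + c"
proof -
  obtain T and q :: "'k mvpoly \<Rightarrow> 'k mvpoly"
    where T: "T \<subseteq> {xpow (lead_expvec p) | p. p \<in> I \<and> p \<noteq> 0}" "xpow a = (\<Sum>t\<in>T. q t * t)"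
    using assms unfolding initial_ideal_def poly_ideal_def by blast
  have "a \<in> keys (\<Sum>t\<in>T. q t * t)"
    by (simp flip: T(2)) (simp add: xpow_def)
  then have "a \<in> (\<Union>t\<in>T. keys (q t * t))"
    by (rule subsetD[OF keys_sum])
  then obtain t where t: "t \<in> T" "a \<in> keys (q t * t)"
    by blast
  from t(1) T(1) obtain p where p: "p \<in> I" "p \<noteq> 0" "t = xpow (lead_expvec p)"
    by blast
  have "a \<in> keys (xpow (lead_expvec p) * q t)"
    using t(2) p(3) by (simp add: mult.commute)
  then show ?thesis
    using keys_xpow_times p(1,2) that by blast
qed

text \<open>A multiple of a leading monomial can be minimal only with trivial cofactor, since that
  leading monomial lies in the initial ideal itself.\<close>

lemma minimal_generator_is_lead:
  assumes "minimal_generator n (initial_ideal n I) a"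
  obtains p where "p \<in> I" "p \<noteq> 0" "lead_expvec p = a"
proof -
  obtain p c where p: "p \<in> I" "p \<noteq> 0" "a = lead_expvec p + c"
    using assms initial_idealE unfolding minimal_generator_def by metis
  have "c = 0"
    using initial_ideal_leadI[OF p(1,2), of n] p(3) assms unfolding minimal_generator_def by blast
  then show ?thesis
    using p that by simp
qed

section \<open>Ideals generated by generic forms\<close>

locale generic_system =
  fixes F :: "'k::field set" and n r :: nat and d :: "nat \<Rightarrow> nat" and f :: "nat \<Rightarrow> 'k mvpoly"
  assumes subfield: "is_subfield F" and generic: "generic_forms F n r d f"
begin

abbreviation ideal :: "'k mvpoly set" where
  "ideal \<equiv> poly_ideal n (f ` {1..r})"

lemma keys_form: "i \<in> {1..r} \<Longrightarrow> keys (f i) \<subseteq> monomials_in_deg {1..n} (d i)"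
  using generic by (simp add: generic_forms_def generic_form_def)

lemma idealE:
  assumes "p \<in> ideal"
  obtains q where "\<And>i. i \<in> {1..r} \<Longrightarrow> q i \<in> poly_ring n" "p = (\<Sum>i\<in>{1..r}. q i * f i)"
  using assms unfolding poly_ideal_image_iff[OF finite_atLeastAtMost] by blast

lemma keys_multiple:
  assumes "i \<in> {1..r}" "y \<in> keys (xpow g * f i)"
  obtains b where "y = g + b" "b \<in> monomials_in {1..n}" "mon_deg b = d i"
  using keys_xpow_times[OF assms(2)] keys_form[OF assms(1)] by (auto simp: monomials_in_deg_def)

text \<open>Each term is a product of a term of a cofactor and a term of some \<open>f i\<close>.
  The degree bound later shows that a minimal generator has degree at least
  \<open>d 1\<close>.\<close>

lemma keys_ideal:
  assumes "p \<in> ideal" "y \<in> keys p"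
  shows "y \<in> monomials_in {1..n}" and "\<exists>i\<in>{1..r}. d i \<le> mon_deg y"
proof -
  obtain q where q: "\<And>i. i \<in> {1..r} \<Longrightarrow> q i \<in> poly_ring n" "p = (\<Sum>i\<in>{1..r}. q i * f i)"
    using assms(1) by (rule idealE) blast
  obtain i where i: "i \<in> {1..r}" "y \<in> keys (q i * f i)"
    using subsetD[OF keys_sum assms(2)[unfolded q(2)]] by blast
  then obtain g b where g: "g \<in> keys (q i)" "b \<in> keys (f i)" "y = g + b"
    using keys_mult[of "q i" "f i"] by blast
  have "g \<in> monomials_in {1..n}"
    using q(1)[OF i(1)] g(1) by (auto simp: poly_ring_def)
  moreover have b: "b \<in> monomials_in {1..n}" "mon_deg b = d i"
    using keys_form[OF i(1)] g(2) by (auto simp: monomials_in_deg_def)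
  ultimately show "y \<in> monomials_in {1..n}"
    by (simp add: g(3) monomials_in_add_iff)
  show "\<exists>i\<in>{1..r}. d i \<le> mon_deg y"
    using i(1) b(2) by (intro bexI[of _ i]) (simp_all add: g(3) mon_deg_add)
qed

text \<open>
  A pair \<open>(i, g)\<close> stands for the multiple \<open>x\<^sup>g f\<^sub>i\<close>; modulo \<open>x\<^sub>m, \<dots>, x\<^sub>n\<close> those with index in
  \<open>multiples m D\<close> span the part of degree \<open>D\<close> of the ideal.
\<close>

definition multiples :: "nat \<Rightarrow> nat \<Rightarrow> (nat \<times> expvec) set" where
  "multiples m D = (SIGMA i:{1..r}. {g \<in> monomials_in {1..<m}. mon_deg g + d i = D})"

text \<open>What the multiple indexed by \<open>x\<close> becomes when each \<open>f i\<close> is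
  replaced by \<open>xpow (\<alpha> i)\<close>. It also labels the row belonging to \<open>x\<close>
  in the coefficient matrix, which is thereby square.\<close>

definition specialized :: "(nat \<Rightarrow> expvec) \<Rightarrow> nat \<times> expvec \<Rightarrow> expvec" where
  "specialized \<alpha> x = snd x + \<alpha> (fst x)"

text \<open>The bound \<open>m \<le> Suc n\<close> keeps the variables of index below
  \<open>m\<close> among \<open>x\<^sub>1, \<dots>, x\<^sub>n\<close>, so that the chosen monomials
  have coefficients in the independent family.\<close>

definition special_monomials :: "nat \<Rightarrow> (nat \<Rightarrow> expvec) \<Rightarrow> bool" where
  "special_monomials m \<alpha> \<longleftrightarrow> m \<le> Suc n \<and> (\<forall>i\<in>{1..r}. \<alpha> i \<in> monomials_in_deg {1..<m} (d i))"

lemma finite_multiples: "finite (multiples m D)"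
proof (rule finite_subset)
  show "multiples m D \<subseteq> {1..r} \<times> (\<Union>e\<in>{..D}. monomials_in_deg {1..<m} e)"
    by (auto simp: multiples_def monomials_in_deg_def)
  show "finite ({1..r} \<times> (\<Union>e\<in>{..D}. monomials_in_deg {1..<m} e))"
    by (simp add: finite_monomials_in_deg)
qed

lemma specialized_in:
  assumes "special_monomials m \<alpha>" "x \<in> multiples m D"
  shows "specialized \<alpha> x \<in> monomials_in_deg {1..<m} D"
  using assms by (auto simp: special_monomials_def multiples_def specialized_def monomials_in_deg_def
      monomials_in_add_iff mon_deg_add)

text \<open>Specializing each \<open>f\<^sub>i\<close> to \<open>xpow (\<alpha> i)\<close> turns the coefficient matrix below into the identity.\<close>

lemma multiples_nonsingular:
  assumes \<alpha>: "special_monomials m \<alpha>" and X: "X \<subseteq> multiples m D" and inj: "inj_on (specialized \<alpha>) X"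
  shows "\<And>v. (\<And>x. x \<in> X \<Longrightarrow>
        (\<Sum>y\<in>X. lookup (xpow (snd y) * f (fst y)) (specialized \<alpha> x) * v y) = 0) \<Longrightarrow>
      (\<And>x. x \<in> X \<Longrightarrow> v x = 0)"
    and "\<And>x0. \<exists>v. \<forall>x\<in>X.
        (\<Sum>y\<in>X. lookup (xpow (snd y) * f (fst y)) (specialized \<alpha> x) * v y) = (if x = x0 then 1 else 0)"
proof -
  let ?c = "\<lambda>(i, b). lookup (f i) b"
  let ?J = "SIGMA i:{1..r}. monomials_in_deg {1..n} (d i)"
  \<comment> \<open>\<open>e x y\<close> records which coefficient of which form stands in row
    \<open>specialized \<alpha> x\<close> and column \<open>y\<close>. Subtraction of exponent
    vectors is truncated, hence the divisibility test.\<close>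
  define e :: "nat \<times> expvec \<Rightarrow> nat \<times> expvec \<Rightarrow> (nat \<times> expvec) option"
    where "e x y = (if \<exists>b. specialized \<alpha> x = snd y + b
      then Some (fst y, specialized \<alpha> x - snd y) else None)" for x y
  have e_Some: "e x y = Some j \<longleftrightarrow> fst j = fst y \<and> specialized \<alpha> x = snd y + snd j" for x y j
    by (cases j) (auto simp: e_def)
  have entry: "entry ?c (e x y) = lookup (xpow (snd y) * f (fst y)) (specialized \<alpha> x)" for x y
  proof (cases "\<exists>b. specialized \<alpha> x = snd y + b")
    case True
    then show ?thesis
      by (auto simp: e_def lookup_xpow_times)
  next
    case False
    then have "specialized \<alpha> x \<notin> keys (xpow (snd y) * f (fst y))"
      using keys_xpow_times by blast
    then show ?thesis
      using False by (simp add: e_def in_keys_iff)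
  qed
  have c: "alg_indep_family F ?J ?c"
    using generic by (simp add: generic_forms_def)
  have J: "j \<in> ?J" if x: "x \<in> X" and y: "y \<in> X" and j: "e x y = Some j" for x y j
  proof -
    have *: "fst j = fst y" "specialized \<alpha> x = snd y + snd j"
      using j by (simp_all add: e_Some)
    have "snd y + snd j \<in> monomials_in_deg {1..<m} D"
      using specialized_in[OF \<alpha> subsetD[OF X x]] *(2) by simp
    moreover have "mon_deg (snd y) + d (fst y) = D" "fst y \<in> {1..r}"
      using y X by (auto simp: multiples_def)
    moreover have "monomials_in {1..<m} \<subseteq> monomials_in {1..n}"
      using \<alpha> by (intro monomials_in_mono) (auto simp: special_monomials_def)
    ultimately show ?thesis
      using *(1) by (cases j) (auto simp: monomials_in_deg_def monomials_in_add_iff mon_deg_add)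
  qed
  \<comment> \<open>Only the coefficient of \<open>\<alpha> i\<close> in each \<open>f i\<close> is
    set to 1. Column \<open>y\<close> then has its only 1 in row
    \<open>specialized \<alpha> y\<close>, and injectivity on \<open>X\<close> identifies that row
    with \<open>y\<close>.\<close>
  have S: "(\<exists>j\<in>range (\<lambda>i. (i, \<alpha> i)). e x y = Some j) \<longleftrightarrow> x = y" if "x \<in> X" "y \<in> X" for x y
  proof -
    have "(\<exists>j\<in>range (\<lambda>i. (i, \<alpha> i)). e x y = Some j) \<longleftrightarrow> specialized \<alpha> x = specialized \<alpha> y"
      by (auto simp: e_Some specialized_def)
    then show ?thesis
      using inj that by (auto simp: inj_on_def)
  qed
  have fin: "finite X"
    using X finite_multiples finite_subset by blast
  note * = alg_indep_nonsingular[OF subfield c J fin S, unfolded entry]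
  show "\<And>v. (\<And>x. x \<in> X \<Longrightarrow>
        (\<Sum>y\<in>X. lookup (xpow (snd y) * f (fst y)) (specialized \<alpha> x) * v y) = 0) \<Longrightarrow>
      (\<And>x. x \<in> X \<Longrightarrow> v x = 0)"
    by (rule *(1))
  show "\<And>x0. \<exists>v. \<forall>x\<in>X.
        (\<Sum>y\<in>X. lookup (xpow (snd y) * f (fst y)) (specialized \<alpha> x) * v y) = (if x = x0 then 1 else 0)"
    by (rule *(2))
qed

text \<open>Solving the nonsingular system gives a form \<open>p\<close> in the ideal with
  coefficient 1 at \<open>\<nu>\<close> and 0 at every other monomial of degree \<open>D\<close> in
  the variables of index below \<open>m\<close>. Its remaining terms involve later variables and are
  therefore smaller than \<open>\<nu>\<close>.\<close>

lemma surjective_specialization: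
  assumes \<alpha>: "special_monomials m \<alpha>"
    and surj: "monomials_in_deg {1..<m} D \<subseteq> specialized \<alpha> ` multiples m D"
    and \<nu>: "\<nu> \<in> monomials_in_deg {1..<m} D"
  shows "xpow \<nu> \<in> initial_ideal n ideal"
proof -
  \<comment> \<open>One preimage is kept per monomial, so that rows and columns match.\<close>
  obtain X where X: "X \<subseteq> multiples m D" "inj_on (specialized \<alpha>) X"
      "monomials_in_deg {1..<m} D = specialized \<alpha> ` X"
    using surj by (meson subset_image_inj)
  obtain x0 where x0: "x0 \<in> X" "\<nu> = specialized \<alpha> x0"
    using \<nu> X(3) by blast
  obtain v where v: "\<And>x. x \<in> X \<Longrightarrow>
      (\<Sum>y\<in>X. lookup (xpow (snd y) * f (fst y)) (specialized \<alpha> x) * v y) = (if x = x0 then 1 else 0)"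
    using multiples_nonsingular(2)[OF \<alpha> X(1,2), of x0] by auto
  define p where "p = (\<Sum>y\<in>X. Poly_Mapping.single (snd y) (v y) * f (fst y))"
  have mono: "monomials_in {1..<m} \<subseteq> monomials_in {1..n}"
    using \<alpha> by (intro monomials_in_mono) (auto simp: special_monomials_def)
  have p: "p \<in> ideal"
    unfolding p_def
  proof (rule poly_ideal_image_sum)
    fix y assume "y \<in> X"
    then have "fst y \<in> {1..r}" "snd y \<in> monomials_in {1..<m}"
      using X(1) by (auto simp: multiples_def)
    then show "Poly_Mapping.single (snd y) (v y) * f (fst y) \<in> ideal"
      using mono by (intro poly_ideal_image_times poly_ring_single) auto
  qed simp
  have lookup_p: "lookup p b = (\<Sum>y\<in>X. lookup (xpow (snd y) * f (fst y)) b * v y)" for b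
    unfolding p_def lookup_sum
    by (rule sum.cong[OF refl], subst single_eq_xpow, subst mult.assoc)
      (simp add: lookup_single_0_times mult.commute)
  have deg_p: "mon_deg b = D" if b: "b \<in> keys p" for b
  proof -
    have "(\<Sum>y\<in>X. lookup (xpow (snd y) * f (fst y)) b * v y) \<noteq> 0"
      using b lookup_p by (simp add: in_keys_iff)
    then obtain y where y: "y \<in> X" "lookup (xpow (snd y) * f (fst y)) b * v y \<noteq> 0"
      by (rule sum.not_neutral_contains_not_neutral)
    then have y': "fst y \<in> {1..r}" "mon_deg (snd y) + d (fst y) = D"
      using X(1) by (auto simp: multiples_def)
    have "b \<in> keys (xpow (snd y) * f (fst y))"
      using y(2) by (auto simp: in_keys_iff)
    then show ?thesis
      using keys_multiple[OF y'(1)] y'(2) by (metis mon_deg_add)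
  qed
  have "lookup p \<nu> = 1"
    using v[OF x0(1)] by (simp add: lookup_p x0(2))
  then have \<nu>_key: "\<nu> \<in> keys p"
    by (simp add: in_keys_iff)
  have "lead_expvec p = \<nu>"
  proof (rule lead_expvec_eqI[OF \<nu>_key])
    fix b assume b: "b \<in> keys p" "b \<noteq> \<nu>"
    have "b \<notin> monomials_in {1..<m}"
    proof
      assume "b \<in> monomials_in {1..<m}"
      then have "b \<in> specialized \<alpha> ` X"
        using deg_p[OF b(1)] by (simp flip: X(3) add: monomials_in_deg_def)
      then obtain x where x: "x \<in> X" "b = specialized \<alpha> x"
        by blast
      then have "x \<noteq> x0"
        using b(2) x0 by blast
      then have "lookup p b = 0"
        using v[OF x(1)] by (simp add: lookup_p x(2))
      then show False
        using b(1) by (simp add: in_keys_iff)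
    qed
    then show "drl_less b \<nu>"
      using \<nu> keys_ideal(1)[OF p b(1)] deg_p[OF b(1)]
      by (intro drl_less_leaving_variables) (auto simp: monomials_in_deg_def)
  qed
  moreover have "p \<noteq> 0"
    using \<nu>_key by auto
  ultimately show ?thesis
    using initial_ideal_leadI[OF p, of n] by simp
qed

text \<open>
  A polynomial whose leading monomial of degree \<open>D\<close> involves \<open>x\<^sub>n\<close> has a part of degree \<open>D\<close> divisible
  by \<open>x\<^sub>n\<close>. Since the multiples of the \<open>f\<^sub>i\<close> are independent modulo \<open>x\<^sub>n\<close>, the division by \<open>x\<^sub>n\<close> can
  be carried out on the cofactors and stays inside the ideal, against minimality.
\<close>

lemma injective_specialization:
  assumes \<alpha>: "special_monomials n \<alpha>" and inj: "inj_on (specialized \<alpha>) (multiples n D)"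
    and min: "minimal_generator n (initial_ideal n ideal) \<mu>"
    and D: "mon_deg \<mu> = D"
  shows "n \<notin> keys \<mu>"
proof
  assume n\<mu>: "n \<in> keys \<mu>"
  obtain p where p: "p \<in> ideal" "p \<noteq> 0" "lead_expvec p = \<mu>"
    using min by (rule minimal_generator_is_lead)
  obtain q where q: "\<And>i. i \<in> {1..r} \<Longrightarrow> q i \<in> poly_ring n" "p = (\<Sum>i\<in>{1..r}. q i * f i)"
    using p(1) by (rule idealE) blast
  have "\<mu> \<in> keys p"
    using lead_expvec_in_keys[OF p(2)] p(3) by simp
  \<comment> \<open>Terms of lower degree may occur in \<open>p\<close>, so only its part of degree
    \<open>D\<close> is known to be divisible by \<open>x\<^sub>n\<close>.\<close>
  have n_key: "n \<in> keys y" if "y \<in> keys p" "mon_deg y = D" for y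
    using drl_less_last_variable[of y \<mu> n] lead_expvec_greatest[OF p(2) that(1)] that p(3) D n\<mu>
      keys_ideal(1)[OF p(1) that(1)] by (cases "y = \<mu>") auto
  have lookup_p: "lookup p y = (\<Sum>i\<in>{1..r}. \<Sum>g\<in>keys (q i). lookup (q i) g * lookup (xpow g * f i) y)" for y
    unfolding q(2) lookup_sum by (intro sum.cong refl lookup_times)
  \<comment> \<open>At a monomial \<open>y\<close> of degree \<open>D\<close> free of
    \<open>x\<^sub>n\<close>, \<open>p\<close> has coefficient zero, and only cofactor terms with
    index in \<open>multiples n D\<close> contribute there. Their coefficients thus solve a
    homogeneous nonsingular system.\<close>
  have vanish: "lookup (q i) g = 0" if ig: "(i, g) \<in> multiples n D" for i g
  proof -
    let ?v = "\<lambda>x. lookup (q (fst x)) (snd x)"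
    have "?v (i, g) = 0"
    proof (rule multiples_nonsingular(1)[OF \<alpha> subset_refl inj _ ig])
      fix x assume x: "x \<in> multiples n D"
      define y where "y = specialized \<alpha> x"
      have y: "y \<in> monomials_in {1..<n}" "mon_deg y = D"
        using specialized_in[OF \<alpha> x] by (auto simp: y_def monomials_in_deg_def)
      let ?G = "\<lambda>i. {g \<in> monomials_in {1..<n}. mon_deg g + d i = D}"
      have fin: "finite (?G i)" for i
        by (rule finite_subset[OF _ finite_monomials_in_deg[of "{1..<n}" "D - d i"]])
          (auto simp: monomials_in_deg_def)
      have "(\<Sum>g\<in>keys (q i). lookup (q i) g * lookup (xpow g * f i) y)
          = (\<Sum>g\<in>?G i. lookup (xpow g * f i) y * lookup (q i) g)" if i: "i \<in> {1..r}" for i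
      proof (rule sum.mono_neutral_cong)
        fix g assume g: "g \<in> keys (q i) - ?G i"
        have "y \<notin> keys (xpow g * f i)"
        proof
          assume "y \<in> keys (xpow g * f i)"
          then obtain b where "y = g + b" "mon_deg b = d i"
            using keys_multiple[OF i] by metis
          then show False
            using g y by (auto simp: monomials_in_add_iff mon_deg_add)
        qed
        then show "lookup (q i) g * lookup (xpow g * f i) y = 0"
          by (simp add: in_keys_iff)
      qed (use fin in \<open>auto simp: in_keys_iff\<close>)
      then have "lookup p y = (\<Sum>i\<in>{1..r}. \<Sum>g\<in>?G i. lookup (xpow g * f i) y * lookup (q i) g)"
        by (simp add: lookup_p)
      also have "\<dots> = (\<Sum>z\<in>multiples n D. lookup (xpow (snd z) * f (fst z)) y * ?v z)"
        unfolding multiples_def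
        by (subst sum.Sigma) (use fin in \<open>auto simp: split_def\<close>)
      finally have "(\<Sum>z\<in>multiples n D. lookup (xpow (snd z) * f (fst z)) y * ?v z) = lookup p y"
        by simp
      also have "\<dots> = 0"
      proof -
        have "n \<notin> keys y"
          using y(1) by (auto simp: monomials_in_def)
        then have "y \<notin> keys p"
          using n_key y(2) by blast
        then show ?thesis
          by (simp add: in_keys_iff)
      qed
      finally show "(\<Sum>z\<in>multiples n D.
          lookup (xpow (snd z) * f (fst z)) (specialized \<alpha> x) * ?v z) = 0"
        by (simp add: y_def)
    qed
    then show ?thesis
      by simp
  qed
  define e :: expvec where "e = Poly_Mapping.single n 1"
  \<comment> \<open>The cofactor terms that contribute to degree \<open>D\<close>; by
    \<open>vanish\<close> each of them involves \<open>x\<^sub>n\<close>.\<close>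
  define B where "B i = {g \<in> keys (q i). mon_deg g + d i = D}" for i
  have e_dvd: "e + (g - e) = g" if "n \<in> keys g" for g
  proof (rule poly_mapping_eqI)
    fix k
    show "lookup (e + (g - e)) k = lookup g k"
      using that by (cases "k = n") (auto simp: e_def lookup_add lookup_minus lookup_single in_keys_iff)
  qed
  have B: "e + (g - e) = g" "g - e \<in> monomials_in {1..n}" if i: "i \<in> {1..r}" and g: "g \<in> B i" for i g
  proof -
    have g': "g \<in> monomials_in {1..n}" "lookup (q i) g \<noteq> 0"
      using q(1)[OF i] g by (auto simp: poly_ring_def B_def in_keys_iff)
    have "n \<in> keys g"
    proof (rule ccontr)
      assume "n \<notin> keys g"
      moreover have "{1..n} - {n} = {1..<n}"
        by auto
      ultimately have "(i, g) \<in> multiples n D"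
        using i g g'(1) by (auto simp: multiples_def B_def monomials_in_def)
      then show False
        using vanish g'(2) by blast
    qed
    then show *: "e + (g - e) = g"
      by (rule e_dvd)
    show "g - e \<in> monomials_in {1..n}"
      using g'(1) monomials_in_add_iff[of e "g - e"] unfolding * by simp
  qed
  \<comment> \<open>The part of \<open>p\<close> of degree \<open>D\<close> divided by
    \<open>x\<^sub>n\<close>, with the division done on the cofactors so that \<open>h\<close> lies
    in the ideal.\<close>
  define h where "h = (\<Sum>i\<in>{1..r}. (\<Sum>g\<in>B i. Poly_Mapping.single (g - e) (lookup (q i) g)) * f i)"
  have h: "h \<in> ideal"
    unfolding h_def
    by (rule poly_ideal_image_sum[OF finite_atLeastAtMost],
        rule poly_ideal_image_times[OF finite_atLeastAtMost], assumption,
        rule poly_ring_sum, rule poly_ring_single, rule B(2))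
  have xh: "xpow e * h = (\<Sum>i\<in>{1..r}. (\<Sum>g\<in>B i. Poly_Mapping.single g (lookup (q i) g)) * f i)"
    unfolding h_def sum_distrib_left mult.assoc[symmetric]
    by (intro sum.cong refl arg_cong2[where f = "(*)"])
      (simp add: xpow_def mult_single B(1))
  have lookup_xh: "lookup (xpow e * h) y = (if mon_deg y = D then lookup p y else 0)" for y
  proof -
    have "lookup (xpow e * h) y = (\<Sum>i\<in>{1..r}. \<Sum>g\<in>B i. lookup (q i) g * lookup (xpow g * f i) y)"
      by (simp add: xh lookup_sum lookup_sum_single_times)
    also have "\<dots> = (\<Sum>i\<in>{1..r}. \<Sum>g\<in>keys (q i).
        if mon_deg y = D then lookup (q i) g * lookup (xpow g * f i) y else 0)"
    proof (rule sum.cong[OF refl])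
      fix i assume i: "i \<in> {1..r}"
      have deg: "mon_deg y = mon_deg g + d i" if "lookup (xpow g * f i) y \<noteq> 0" for g
        using keys_multiple[OF i, of y g] that by (metis in_keys_iff mon_deg_add)
      show "(\<Sum>g\<in>B i. lookup (q i) g * lookup (xpow g * f i) y) = (\<Sum>g\<in>keys (q i).
          if mon_deg y = D then lookup (q i) g * lookup (xpow g * f i) y else 0)"
      proof (rule sum.mono_neutral_cong_left)
        show "\<forall>g\<in>keys (q i) - B i.
            (if mon_deg y = D then lookup (q i) g * lookup (xpow g * f i) y else 0) = 0"
          using deg by (auto simp: B_def)
        show "lookup (q i) g * lookup (xpow g * f i) y
            = (if mon_deg y = D then lookup (q i) g * lookup (xpow g * f i) y else 0)" if "g \<in> B i" for g
          using that deg[of g] by (auto simp: B_def)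
      qed (auto simp: B_def)
    qed
    also have "\<dots> = (if mon_deg y = D then lookup p y else 0)"
      by (simp add: lookup_p)
    finally show ?thesis .
  qed
  have lookup_h: "lookup h b = (if mon_deg (e + b) = D then lookup p (e + b) else 0)" for b
    using lookup_xh[of "e + b"] by (simp add: lookup_xpow_times)
  \<comment> \<open>Multiplication by \<open>x\<^sub>n\<close> preserves the order, so the proper
    divisor \<open>b0\<close> of \<open>\<mu>\<close> is the leading monomial of
    \<open>h\<close>.\<close>
  define b0 where "b0 = \<mu> - e"
  have \<mu>: "\<mu> = e + b0"
    unfolding b0_def by (rule e_dvd[OF n\<mu>, symmetric])
  have "b0 \<in> keys h"
    using \<open>\<mu> \<in> keys p\<close> D by (simp add: in_keys_iff lookup_h flip: \<mu>)
  moreover have "lead_expvec h = b0"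
  proof (rule lead_expvec_eqI[OF \<open>b0 \<in> keys h\<close>])
    fix b assume b: "b \<in> keys h" "b \<noteq> b0"
    then have "e + b \<in> keys p" "e + b \<noteq> \<mu>"
      by (auto simp: in_keys_iff lookup_h \<mu> split: if_splits)
    then have "drl_less (e + b) (e + b0)"
      using lead_expvec_greatest[OF p(2)] p(3) by (simp flip: \<mu>)
    then show "drl_less b b0"
      by (simp add: drl_less_add_cancel)
  qed
  moreover have "h \<noteq> 0"
    using \<open>b0 \<in> keys h\<close> by auto
  ultimately have "xpow b0 \<in> initial_ideal n ideal"
    using initial_ideal_leadI[OF h, of n] by simp
  moreover have "\<mu> = b0 + e" "e \<noteq> 0"
    using \<mu> by (simp_all add: add.commute e_def flip: mon_deg_eq_0_iff)
  ultimately show False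
    using min unfolding minimal_generator_def by blast
qed

end

section \<open>Pardue's conjecture in at most three variables\<close>

definition bimonomial :: "nat \<Rightarrow> nat \<Rightarrow> expvec" where
  "bimonomial a b = Poly_Mapping.single 1 a + Poly_Mapping.single 2 b"

lemma lookup_bimonomial [simp]: "lookup (bimonomial a b) (Suc 0) = a"
  by (simp add: bimonomial_def lookup_add lookup_single)

lemma bimonomial_in_deg_iff: "bimonomial a b \<in> monomials_in_deg {1..<3} D \<longleftrightarrow> a + b = D"
  by (auto simp: bimonomial_def monomials_in_deg_def monomials_in_def keys_add_nat mon_deg_add)

lemma bimonomial_add: "bimonomial a b + bimonomial a' b' = bimonomial (a + a') (b + b')"
  by (simp add: bimonomial_def single_add ac_simps)

lemma bimonomialE:
  assumes "g \<in> monomials_in {1..<3}"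
  obtains a b where "g = bimonomial a b"
proof
  have "{1..<3} = {1, 2::nat}"
    by auto
  then have "lookup g i = 0" if "i \<noteq> 1" "i \<noteq> 2" for i
    using assms that unfolding monomials_in_def by (auto simp: in_keys_iff)
  then show "g = bimonomial (lookup g 1) (lookup g 2)"
    by (intro poly_mapping_eqI) (auto simp: bimonomial_def lookup_add lookup_single when_def)
qed

theorem theorem4p3:
  fixes F :: "'k::field set" and n :: nat and d :: "nat \<Rightarrow> nat" and I :: "'k mvpoly set"
  assumes "infinite (UNIV :: 'k set)"
    and "is_subfield F"
    and "1 \<le> n" and "n \<le> 3"
    and "\<forall>i\<in>{1..n}. 0 < d i"
    and "\<forall>i\<in>{1..n}. \<forall>j\<in>{1..n}. i \<le> j \<longrightarrow> d i \<le> d j"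
    and "generic_homogeneous_ideal F n n d I"
  shows "pardue_conjecture_holds n I"
proof -
  obtain f where f: "generic_forms F n n d f" and I: "I = poly_ideal n (f ` {1..n})"
    using assms(7) unfolding generic_homogeneous_ideal_def by blast
  interpret generic_system F n n d f
    by unfold_locales (fact assms(2), fact f)
  have "xpow \<nu> \<in> initial_ideal n ideal"
    if min: "minimal_generator n (initial_ideal n ideal) \<mu>" and m: "max_index \<mu> = m"
      and D: "mon_deg \<mu> = D" and \<nu>: "\<nu> \<in> monomials_in_deg {1..<m} D" for \<mu> \<nu> m D
  proof -
    obtain p where p: "p \<in> ideal" "p \<noteq> 0" "lead_expvec p = \<mu>"
      using min by (rule minimal_generator_is_lead)
    then have "\<exists>i\<in>{1..n}. d i \<le> D"
      using keys_ideal(2)[OF p(1)] lead_expvec_in_keys[OF p(2)] D by blast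
    then have d1: "d 1 \<le> D"
      using assms(3,6) by (meson atLeastAtMost_iff order_refl order_trans)
    \<comment> \<open>Positivity excludes \<open>\<mu> = 0\<close>, where \<open>max_index\<close>
      carries no information.\<close>
    have "0 < d 1"
      using assms(3,5) by simp
    then have "\<mu> \<noteq> 0"
      using d1 D by auto
    then have "m \<in> keys \<mu>"
      using m Max_in[of "keys \<mu>"] by (auto simp: max_index_def)
    then have m_range: "m \<in> {1..n}"
      using min by (auto simp: minimal_generator_def monomials_in_def)
    then consider "m = 1" | "m = 2" | "m = 3"
      using assms(4) by fastforce
    then show ?thesis
    proof cases
      case 1
      \<comment> \<open>No variables remain, so the only candidate is the monomial 1, whose degree 0
        is below \<open>d 1\<close>.\<close>
      then have "\<nu> = 0"
        using \<nu> by (auto simp: monomials_in_deg_def monomials_in_def)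
      then show ?thesis
        using \<nu> d1 \<open>0 < d 1\<close> by (simp add: monomials_in_deg_def)
    next
      case 2
      \<comment> \<open>The only monomial to reach is \<open>x\<^sub>1\<^sup>D\<close>, and a
        multiple of \<open>f 1\<close> specializes to it because \<open>d 1 \<le> D\<close>.\<close>
      define \<alpha> where "\<alpha> i = Poly_Mapping.single (1::nat) (d i)" for i
      have "special_monomials 2 \<alpha>"
        using m_range 2 by (auto simp: special_monomials_def \<alpha>_def monomials_in_deg_def monomials_in_def)
      moreover have "monomials_in_deg {1..<2} D \<subseteq> specialized \<alpha> ` multiples 2 D"
      proof
        fix b assume b: "b \<in> monomials_in_deg {1..<2} D"
        have "lookup b i = 0" if "i \<noteq> 1" for i
          using b that by (auto simp: monomials_in_deg_def monomials_in_def in_keys_iff)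
        then have "b = Poly_Mapping.single 1 (lookup b 1)"
          by (intro poly_mapping_eqI) (auto simp: lookup_single when_def)
        moreover from this have "lookup b 1 = D"
          using b mon_deg_single[of 1 "lookup b 1"] by (simp add: monomials_in_deg_def)
        ultimately have "b = specialized \<alpha> (1, Poly_Mapping.single 1 (D - d 1))"
          using d1 by (simp add: specialized_def \<alpha>_def flip: single_add)
        moreover have "(1, Poly_Mapping.single 1 (D - d 1)) \<in> multiples 2 D"
          using d1 assms(3) by (auto simp: multiples_def monomials_in_def)
        ultimately show "b \<in> specialized \<alpha> ` multiples 2 D"
          by blast
      qed
      ultimately show ?thesis
        using \<nu> 2 by (intro surjective_specialization[of 2 \<alpha> D]) auto
    next
      case 3
      then have n: "n = 3"
        using m_range assms(4) by simp
      have d12: "d 1 \<le> d 2" and d23: "d 2 \<le> d 3"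
        using assms(6) n by auto
      have range: "{1..n} = {1, 2, 3}"
        using n by auto
      \<comment> \<open>The first two forms miss the exponents \<open>a\<close> of
        \<open>x\<^sub>1\<close> with \<open>a < d 1\<close> and \<open>D - a < d 2\<close>, that
        is, from \<open>D + 1 - d 2\<close> to \<open>d 1 - 1\<close>; this gap is nonempty exactly
        if \<open>D + 2 \<le> d 1 + d 2\<close>. If the gap is empty or \<open>f 3\<close> has no
        multiples in degree \<open>D\<close>, the value 0 serves as a default. In the other case
        \<open>k < d 1 \<le> d 3\<close>, so \<open>d 3 - k\<close> is a true difference.\<close>
      define k where "k = (if d 3 \<le> D \<and> D + 2 \<le> d 1 + d 2 then D + 1 - d 2 else 0)"
      have k: "k \<le> d 3"
        unfolding k_def using d12 d23 by auto
      define \<alpha> where "\<alpha> i = (if i = 1 then bimonomial (d 1) 0 else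
        if i = 2 then bimonomial 0 (d 2) else bimonomial k (d 3 - k))" for i :: nat
      have \<alpha>: "special_monomials 3 \<alpha>"
        unfolding special_monomials_def range using n k
        by (auto simp: \<alpha>_def bimonomial_in_deg_iff simp del: One_nat_def)
      have multiples_iff: "(i, bimonomial a b) \<in> multiples 3 D \<longleftrightarrow> i \<in> {1, 2, 3} \<and> a + b + d i = D"
        for i a b
        using bimonomial_in_deg_iff[of a b "a + b"]
        unfolding multiples_def range by (auto simp: monomials_in_deg_def)
      \<comment> \<open>The multiples of \<open>f 3\<close> occupy the exponents from
        \<open>k\<close> to \<open>k + D - d 3\<close>. The condition says that the gap is nonempty
        and that these multiples are absent or end before \<open>d 1\<close>: then there are no
        collisions. Otherwise there is no gap, or it is filled.\<close>
      show ?thesis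
      proof (cases "D + 2 \<le> d 1 + d 2 \<and> (D < d 3 \<or> k + D < d 1 + d 3)")
        case True
        have "inj_on (specialized \<alpha>) (multiples 3 D)"
        proof (rule inj_onI)
          fix x y assume x: "x \<in> multiples 3 D" and y: "y \<in> multiples 3 D"
            and eq: "specialized \<alpha> x = specialized \<alpha> y"
          have "snd x \<in> monomials_in {1..<3}"
            using x by (auto simp: multiples_def)
          then obtain a b where ab: "snd x = bimonomial a b"
            by (rule bimonomialE)
          have "snd y \<in> monomials_in {1..<3}"
            using y by (auto simp: multiples_def)
          then obtain a' b' where ab': "snd y = bimonomial a' b'"
            by (rule bimonomialE)
          have x': "fst x \<in> {1, 2, 3}" "a + b + d (fst x) = D"
            using x multiples_iff[of "fst x" a b] by (simp_all flip: ab)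
          have y': "fst y \<in> {1, 2, 3}" "a' + b' + d (fst y) = D"
            using y multiples_iff[of "fst y" a' b'] by (simp_all flip: ab')
          \<comment> \<open>The exponent of \<open>x\<^sub>1\<close> alone reveals the form: the
            three forms occupy disjoint intervals of exponents.\<close>
          have "lookup (specialized \<alpha> x) 1 = lookup (specialized \<alpha> y) 1"
            using eq by simp
          then have "a + lookup (\<alpha> (fst x)) 1 = a' + lookup (\<alpha> (fst y)) 1"
            by (simp add: specialized_def ab ab' lookup_add)
          then have "fst x = fst y"
            using x' y' True d12 d23 by (auto simp: \<alpha>_def k_def split: if_splits)
          then show "x = y"
            using eq by (simp add: specialized_def prod_eq_iff)
        qed
        then have "n \<notin> keys \<mu>"
          using injective_specialization[of \<alpha> D \<mu>] \<alpha> min D n by simp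
        then show ?thesis
          using \<open>m \<in> keys \<mu>\<close> n 3 by simp
      next
        case False
        have "monomials_in_deg {1..<3} D \<subseteq> specialized \<alpha> ` multiples 3 D"
        proof
          fix y assume y: "y \<in> monomials_in_deg {1..<3} D"
          then obtain a b where ab: "y = bimonomial a b"
            using bimonomialE[of y] by (auto simp: monomials_in_deg_def)
          have D': "a + b = D"
            using y unfolding ab bimonomial_in_deg_iff .
          consider "d 1 \<le> a" | "d 2 \<le> b" | "a < d 1" "b < d 2"
            by linarith
          then show "y \<in> specialized \<alpha> ` multiples 3 D"
          proof cases
            case 1
            then show ?thesis
              using D' by (intro image_eqI[of _ _ "(1, bimonomial (a - d 1) b)"])
                (auto simp: multiples_iff specialized_def \<alpha>_def bimonomial_add ab)
          next
            case 2
            then show ?thesis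
              using D' by (intro image_eqI[of _ _ "(2, bimonomial a (b - d 2))"])
                (auto simp: multiples_iff specialized_def \<alpha>_def bimonomial_add ab)
          next
            case 3
            \<comment> \<open>A monomial missed by the first two forms witnesses a nonempty gap, so
              the failed condition leaves only the case where \<open>f 3\<close> has multiples
              reaching at least to exponent \<open>d 1\<close>.\<close>
            then have "k = D + 1 - d 2" "d 3 \<le> D" "d 1 + d 3 \<le> k + D"
              using False D' by (auto simp: k_def)
            then have "k \<le> a" "d 3 - k \<le> b" "a - k + (b - (d 3 - k)) + d 3 = D"
              using 3 D' d23 k by auto
            then show ?thesis
              by (intro image_eqI[of _ _ "(3, bimonomial (a - k) (b - (d 3 - k)))"])
                (auto simp: multiples_iff specialized_def \<alpha>_def bimonomial_add ab)
          qed
        qed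
        then show ?thesis
          using \<nu> 3 \<alpha> by (intro surjective_specialization[of 3 \<alpha> D]) auto
      qed
    qed
  qed
  then show ?thesis
    unfolding pardue_conjecture_holds_def I by blast
qed

end
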